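(* $I^\alpha$ is representable for every ordinal $\alpha<\omega_1$.
   Context: Two linearly ordered sets are similar if there is an order preserving bijection between them. Real valued functions are partially ordered pointwise: $f\le g$ iff $f(x)\le g(x)$ for all $x$. A linearly ordered set is representable if it is similar to a set of Baire 1 functions $\mathbb{R}\to\mathbb{R}$ that is linearly ordered by the pointwise ordering. Here $I=[0,1]$, and for an ordinal $\alpha$, $I^\alpha$ is the set of transfinite sequences of length $\alpha$ in $I$ (functions $\alpha\to I$) with the lexicographical ordering: $f<g$ iff for some $\beta<\alpha$ we have $f(\beta)<g(\beta)$ and $f(\gamma)=g(\gamma)$ for every $\gamma<\beta$. *)

theory Defs
  imports "HOL-Analysis.Analysis"
begin

unbundle cardinal_syntax

text \<open>Linearly ordered sets are reflexive linear order relations \<open>r\<close> on their field, as in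
  the order theory of Main; the underlying set is \<open>Field r\<close>.\<close>

text \<open>For linear orders the equivalence below is equivalent to its forward implication alone.\<close>

definition similar :: "'a rel \<Rightarrow> 'b rel \<Rightarrow> bool" where
  "similar r s \<longleftrightarrow> (\<exists>h. bij_betw h (Field r) (Field s) \<and>
     (\<forall>x\<in>Field r. \<forall>y\<in>Field r. (x, y) \<in> r \<longleftrightarrow> (h x, h y) \<in> s))"

definition baire1 :: "(real \<Rightarrow> real) \<Rightarrow> bool" where
  "baire1 f \<longleftrightarrow> (\<exists>g :: nat \<Rightarrow> real \<Rightarrow> real.
     (\<forall>n. continuous_on UNIV (g n)) \<and> (\<forall>x. (\<lambda>n. g n x) \<longlonglongrightarrow> f x))"

text \<open>The order \<open>(\<le>)\<close> on functions is the pointwise one.\<close>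

definition representable :: "'a rel \<Rightarrow> bool" where
  "representable r \<longleftrightarrow> Linear_order r \<and>
     (\<exists>F :: (real \<Rightarrow> real) set. (\<forall>f\<in>F. baire1 f) \<and>
        linear_order_on F (relation_of (\<le>) F) \<and>
        similar r (relation_of (\<le>) F))"

text \<open>Ordinals are well-order relations \<open>r\<close>, compared by \<open><o\<close>, which entails that both sides
  are well-orders. The first uncountable ordinal is the initial ordinal of the successor
  cardinal of \<open>natLeq\<close>.\<close>

definition omega1 :: "nat set rel" where
  "omega1 = cardSuc natLeq"

text \<open>The positions below the ordinal \<open>r\<close> are the elements of \<open>Field r\<close>, and \<open>underS r b\<close>
  is the set of positions strictly before \<open>b\<close>.\<close>

definition lex_less :: "'a rel \<Rightarrow> ('a \<Rightarrow> real) \<Rightarrow> ('a \<Rightarrow> real) \<Rightarrow> bool" where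
  "lex_less r f g \<longleftrightarrow> (\<exists>b\<in>Field r. f b < g b \<and> (\<forall>c\<in>underS r b. f c = g c))"

definition I_power :: "'a rel \<Rightarrow> ('a \<Rightarrow> real) rel" where
  "I_power r = relation_of (\<lambda>f g. f = g \<or> lex_less r f g) (Field r \<rightarrow>\<^sub>E {0..1})"

end

theory Submission
  imports Defs "HOL-Library.Countable_Set_Type"
begin

text \<open>
  For countable \<open>\<alpha>\<close> the cube \<open>I\<^sup>\<alpha>\<close>, with the product topology, is a compact metrizable space.
  For a point \<open>x\<close> in it, the initial segment \<open>{t. t < x}\<close> of the lexicographic order is
  the union over the countably many positions \<open>b\<close> of the sets
  \<open>{t. t b < x b \<and> (\<forall>c<b. t c = x c)}\<close>. Each of these is the intersection of an open set with
  a closed one, so the initial segment is an \<open>F\<^sub>\<sigma>\<close> set. Its complement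
  \<open>{x} \<union> {t. x < t}\<close> is \<open>F\<^sub>\<sigma>\<close> for the same reason. The indicator function of a set that is
  \<open>F\<^sub>\<sigma>\<close> together with its complement is of Baire class 1, by Urysohn's lemma
  (\<open>baire1_indicator\<close>), and initial segments of a linear order are strictly increasing in
  their endpoint. This represents \<open>I\<^sup>\<alpha>\<close> by functions on \<open>I\<^sup>\<alpha>\<close> instead of the real line.

  The indicators are moved to the real line by composing them with a continuous surjection from
  \<open>\<real>\<close> onto the cube. Schoenberg's space-filling curve is such a map: with
  the entries of a 0-1 sequence encoded as ternary digits 0 and 2 of a real number, a continuous
  periodic function recovers every single entry (\<open>digit_wave_ternary\<close>), and the
  entries are then distributed over countably many coordinates as binary digits
  (\<open>schoenberg_surj\<close>).
\<close>

section \<open>Indicators of ambiguous sets\<close>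

lemma baire1_indicator:
  fixes S :: "real set"
  assumes "fsigma_in euclidean S" "fsigma_in euclidean (- S)"
  shows "baire1 (indicator S)"
proof -
  obtain A where A: "\<And>n. closed (A n)" "\<And>n. A n \<subseteq> A (Suc n)" "\<Union> (range A) = S"
    using assms(1) unfolding fsigma_in_ascending by auto
  obtain B where B: "\<And>n. closed (B n)" "\<And>n. B n \<subseteq> B (Suc n)" "\<Union> (range B) = - S"
    using assms(2) unfolding fsigma_in_ascending by auto
  have "\<exists>g :: real \<Rightarrow> real. continuous_on UNIV g \<and> (\<forall>x\<in>A n. g x = 1) \<and> (\<forall>x\<in>B n. g x = 0)" for n
  proof -
    have "A n \<inter> B n = {}"
      using A(3) B(3) by blast
    then obtain g :: "real \<Rightarrow> real" where "continuous_on UNIV g"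
      "\<And>x. x \<in> A n \<Longrightarrow> g x = 1" "\<And>x. x \<in> B n \<Longrightarrow> g x = 0"
      using Urysohn[OF A(1) B(1)] by metis
    then show ?thesis
      by blast
  qed
  then obtain g :: "nat \<Rightarrow> real \<Rightarrow> real" where g: "\<And>n. continuous_on UNIV (g n)"
    "\<And>n x. x \<in> A n \<Longrightarrow> g n x = 1" "\<And>n x. x \<in> B n \<Longrightarrow> g n x = 0"
    by metis
  have "(\<lambda>n. g n x) \<longlonglongrightarrow> indicator S x" for x
  proof (cases "x \<in> S")
    case True
    then obtain m where "x \<in> A m"
      using A(3) by blast
    then have "x \<in> A n" if "n \<ge> m" for n
      using lift_Suc_mono_le[of A, OF A(2) that] by blast
    then have "g n x = indicator S x" if "n \<ge> m" for n
      using True g(2) that by simp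
    then show ?thesis
      by (intro tendsto_eventually) (auto simp: eventually_sequentially)
  next
    case False
    then obtain m where "x \<in> B m"
      using B(3) by blast
    then have "x \<in> B n" if "n \<ge> m" for n
      using lift_Suc_mono_le[of B, OF B(2) that] by blast
    then have "g n x = indicator S x" if "n \<ge> m" for n
      using False g(3) that by simp
    then show ?thesis
      by (intro tendsto_eventually) (auto simp: eventually_sequentially)
  qed
  then show ?thesis
    unfolding baire1_def using g(1) by blast
qed

section \<open>Schoenberg's curve\<close>

text \<open>A function of period 2 that is 0 on \<open>[0, 1/3]\<close> and 1 on \<open>[2/3, 1]\<close>.\<close>

definition digit_wave :: "real \<Rightarrow> real" where
  "digit_wave t = max 0 (min 1 (1/2 - cos (pi * t)))"

text \<open>The \<open>n\<close>-th coordinate of Schoenberg's curve in the cube \<open>[0,1]\<^sup>\<nat>\<close>. If \<open>t\<close>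
  has only ternary digits 0 and 2, then the binary digits of the coordinate are the halves of those
  ternary digits of \<open>t\<close> whose places the pairing function \<open>prod_encode\<close> assigns to \<open>n\<close>.\<close>

definition schoenberg :: "nat \<Rightarrow> real \<Rightarrow> real" where
  "schoenberg n t = (\<Sum>k. digit_wave (3 ^ prod_encode (n, k) * t) / 2 ^ Suc k)"

lemma digit_wave_bounds: "0 \<le> digit_wave t" "digit_wave t \<le> 1"
  by (auto simp: digit_wave_def)

lemma continuous_digit_wave: "continuous_on UNIV (\<lambda>t. digit_wave (c * t))"
  unfolding digit_wave_def by (intro continuous_intros)

lemma digit_wave_low: "0 \<le> u \<Longrightarrow> u \<le> 1/3 \<Longrightarrow> digit_wave u = 0"
  using cos_monotone_0_pi_le[of "pi * u" "pi / 3"] pi_gt_zero mult_left_mono[of u "1/3" pi]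
  by (simp add: digit_wave_def cos_60)

lemma digit_wave_high: "2/3 \<le> u \<Longrightarrow> u \<le> 1 \<Longrightarrow> digit_wave u = 1"
  using cos_monotone_0_pi_le[of "2 * pi / 3" "pi * u"] pi_gt_zero
    mult_left_mono[of "2/3" u pi] mult_left_mono[of u 1 pi]
  by (simp add: digit_wave_def cos_120)

lemma digit_wave_shift: "digit_wave (2 * real N + u) = digit_wave u"
proof -
  have "cos (pi * (2 * real N + u)) = cos (2 * real N * pi + pi * u)"
    by (simp add: algebra_simps)
  also have "\<dots> = cos (pi * u)"
    by (simp only: cos_add cos_2npi sin_2npi mult_1_left mult_zero_left diff_zero)
  finally show ?thesis
    by (simp add: digit_wave_def)
qed

lemma digit_wave_ternary:
  fixes a :: "nat \<Rightarrow> nat"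
  assumes a: "\<And>j. a j \<le> 1"
  shows "digit_wave (3 ^ m * (\<Sum>j. 2 * real (a j) / 3 ^ Suc j)) = real (a m)"
proof -
  define f where "f = (\<lambda>j. 2 * real (a j) / 3 ^ Suc j)"
  define tail where "tail = 3 ^ m * (\<Sum>j. f (j + Suc m))"
  define N where "N = (\<Sum>j<m. a j * 3 ^ (m - Suc j))"
  have geo: "(\<lambda>j. c * (1/3) ^ j) sums (c * (3/2))" for c :: real
    using sums_mult[OF geometric_sums[of "1/3 :: real"], of c] by simp
  have le: "0 \<le> f j \<and> f j \<le> (2/3) * (1/3) ^ j" for j
    using a[of j] by (simp add: f_def power_one_over divide_simps)
  have sm: "summable f"
    by (rule summable_comparison_test'[OF sums_summable[OF geo[of "2/3"]], of 0])
      (use le in auto)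
  have sm': "summable (\<lambda>j. f (j + Suc m))"
    by (subst summable_iff_shift) (rule sm)
  have "(\<Sum>j. f (j + Suc m)) \<le> (\<Sum>j. (2/3) * (1/3) ^ Suc m * (1/3) ^ j)"
    using le[of "_ + Suc m"]
    by (intro suminf_le[OF _ sm' sums_summable[OF geo]])
      (simp add: power_add mult_ac)
  also have "\<dots> = (1/3) ^ Suc m"
    using sums_unique[OF geo[of "(2/3) * (1/3) ^ Suc m"]] by simp
  finally have "tail \<le> 3 ^ m * (1/3) ^ Suc m"
    unfolding tail_def by (intro mult_left_mono) auto
  then have tail_le: "tail \<le> 1/3"
    by (simp add: power_one_over)
  have tail_ge: "0 \<le> tail"
    unfolding tail_def using le by (intro mult_nonneg_nonneg suminf_nonneg[OF sm']) auto
  \<comment> \<open>Multiplication by \<open>3 ^ m\<close> turns the digits before place \<open>m\<close> into an even integer.\<close>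
  have "3 ^ m * f j = 2 * real (a j * 3 ^ (m - Suc j))" if "j < m" for j
  proof -
    have "(3 :: real) ^ m = 3 ^ (m - Suc j) * 3 ^ Suc j"
      using that by (simp flip: power_add power_Suc)
    then show ?thesis
      by (simp add: f_def)
  qed
  then have "3 ^ m * (\<Sum>j<m. f j) = 2 * real N"
    by (simp add: N_def sum_distrib_left)
  moreover have "3 ^ m * f m = 2 * real (a m) / 3"
    by (simp add: f_def)
  moreover have "suminf f = (\<Sum>j. f (j + Suc m)) + ((\<Sum>j<m. f j) + f m)"
    using suminf_split_initial_segment[OF sm, of "Suc m"] by simp
  ultimately have eq: "3 ^ m * suminf f = 2 * real N + (2 * real (a m) / 3 + tail)"
    by (simp add: tail_def distrib_left)
  have "digit_wave (2 * real (a m) / 3 + tail) = real (a m)"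
  proof (cases "a m = 0")
    case True
    then show ?thesis
      using tail_le tail_ge by (simp add: digit_wave_low)
  next
    case False
    then have "a m = 1"
      using a[of m] by simp
    then show ?thesis
      using tail_le tail_ge by (simp add: digit_wave_high)
  qed
  then show ?thesis
    using eq digit_wave_shift[of N] unfolding f_def by simp
qed

lemma binary_expansion:
  fixes y :: real
  assumes "0 \<le> y" "y \<le> 1"
  obtains a :: "nat \<Rightarrow> nat" where "\<And>k. a k \<le> 1" "(\<lambda>k. real (a k) / 2 ^ Suc k) sums y"
proof -
  \<comment> \<open>The remainders are kept in \<open>[0,1]\<close>, not \<open>[0,1)\<close>, so that \<open>y = 1\<close> gets the digits \<open>1,1,1,\<dots>\<close>.\<close>
  define r :: "nat \<Rightarrow> real" where "r = rec_nat y (\<lambda>_ z. 2 * z - of_bool (1/2 \<le> z))"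
  define a :: "nat \<Rightarrow> nat" where "a = (\<lambda>k. of_bool (1/2 \<le> r k))"
  have r0: "r 0 = y" and rS: "r (Suc k) = 2 * r k - real (a k)" for k
    by (simp_all add: r_def a_def)
  have r01: "0 \<le> r k \<and> r k \<le> 1" for k
  proof (induction k)
    case 0
    then show ?case
      using assms by (simp add: r0)
  next
    case (Suc k)
    then show ?case
      unfolding rS a_def by auto
  qed
  have part: "(\<Sum>k<n. real (a k) / 2 ^ Suc k) = y - r n * (1/2) ^ n" for n
    by (induction n) (auto simp: r0 rS field_simps)
  have "(\<lambda>n. r n * (1/2) ^ n) \<longlonglongrightarrow> 0"
  proof (rule tendsto_sandwich[of "\<lambda>_. 0" _ _ "\<lambda>n. (1/2) ^ n"])
    show "(\<lambda>n. (1/2 :: real) ^ n) \<longlonglongrightarrow> 0"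
      by (intro LIMSEQ_power_zero) simp
  qed (use r01 in \<open>auto intro!: always_eventually mult_left_le_one_le\<close>)
  then have "(\<lambda>n. y - r n * (1/2) ^ n) \<longlonglongrightarrow> y"
    using tendsto_diff[OF tendsto_const, of _ 0 _ y] by simp
  then have "(\<lambda>k. real (a k) / 2 ^ Suc k) sums y"
    unfolding sums_def part .
  moreover have "a k \<le> 1" for k
    by (simp add: a_def)
  ultimately show ?thesis
    using that by blast
qed

lemma half_powers_sums: "(\<lambda>k. 1 / 2 ^ Suc k :: real) sums 1"
  using power_half_series by (simp add: power_one_over)

lemma schoenberg_term_le: "norm (digit_wave t / 2 ^ Suc k) \<le> 1 / 2 ^ Suc k"
  using digit_wave_bounds[of t] by (simp add: divide_simps)

lemma continuous_schoenberg: "continuous_on UNIV (schoenberg n)"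
proof (rule uniform_limit_theorem)
  show "uniform_limit UNIV
      (\<lambda>m t. \<Sum>k<m. digit_wave (3 ^ prod_encode (n, k) * t) / 2 ^ Suc k) (schoenberg n) sequentially"
    unfolding schoenberg_def
    by (rule Weierstrass_m_test[OF _ sums_summable[OF half_powers_sums]])
      (rule schoenberg_term_le)
  show "\<forall>\<^sub>F m in sequentially. continuous_on UNIV
      (\<lambda>t. \<Sum>k<m. digit_wave (3 ^ prod_encode (n, k) * t) / 2 ^ Suc k)"
    by (intro always_eventually allI continuous_intros continuous_digit_wave) simp
qed simp

lemma schoenberg_bounds: "schoenberg n t \<in> {0..1}"
proof -
  have sm: "summable (\<lambda>k. digit_wave (3 ^ prod_encode (n, k) * t) / 2 ^ Suc k)"
    by (rule summable_comparison_test'[OF sums_summable[OF half_powers_sums]])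
      (rule schoenberg_term_le)
  have "schoenberg n t \<le> (\<Sum>k. 1 / 2 ^ Suc k)"
    unfolding schoenberg_def
    by (intro suminf_le[OF _ sm sums_summable[OF half_powers_sums]] divide_right_mono)
      (auto simp: digit_wave_bounds)
  then have "schoenberg n t \<le> 1"
    using sums_unique[OF half_powers_sums] by simp
  moreover have "0 \<le> schoenberg n t"
    unfolding schoenberg_def by (intro suminf_nonneg[OF sm]) (auto simp: digit_wave_bounds)
  ultimately show ?thesis
    by simp
qed

text \<open>The coordinates are jointly surjective: a single \<open>t\<close> realizes the whole sequence \<open>y\<close>.\<close>

lemma schoenberg_surj:
  fixes y :: "nat \<Rightarrow> real"
  assumes "\<And>n. y n \<in> {0..1}"
  obtains t where "\<And>n. schoenberg n t = y n"
proof -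
  have "\<exists>a :: nat \<Rightarrow> nat. (\<forall>k. a k \<le> 1) \<and> (\<lambda>k. real (a k) / 2 ^ Suc k) sums y n" for n
    using binary_expansion[of "y n"] assms[of n] by (metis atLeastAtMost_iff)
  then obtain a :: "nat \<Rightarrow> nat \<Rightarrow> nat" where
    a: "\<And>n k. a n k \<le> 1" "\<And>n. (\<lambda>k. real (a n k) / 2 ^ Suc k) sums y n"
    by metis
  define c where "c = (\<lambda>j. case prod_decode j of (n, k) \<Rightarrow> a n k)"
  define t where "t = (\<Sum>j. 2 * real (c j) / 3 ^ Suc j)"
  have "c j \<le> 1" for j
    unfolding c_def using a(1) by (auto split: prod.split)
  then have "digit_wave (3 ^ prod_encode (n, k) * t) = real (a n k)" for n k
    unfolding t_def by (subst digit_wave_ternary) (simp_all add: c_def)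
  then have "schoenberg n t = y n" for n
    unfolding schoenberg_def using sums_unique[OF a(2)[of n]] by simp
  then show ?thesis
    using that by blast
qed

section \<open>The lexicographic order\<close>

lemma lex_less_irrefl: "\<not> lex_less r f f"
  by (simp add: lex_less_def)

lemma lex_less_trans:
  assumes r: "Well_order r" and fg: "lex_less r f g" and gh: "lex_less r g h"
  shows "lex_less r f h"
proof -
  have tr: "trans r" and an: "antisym r" and tot: "total_on (Field r) r"
    using r by (auto simp: order_on_defs)
  obtain b where b: "b \<in> Field r" "f b < g b" "\<forall>c\<in>underS r b. f c = g c"
    using fg by (auto simp: lex_less_def)
  obtain d where d: "d \<in> Field r" "g d < h d" "\<forall>c\<in>underS r d. g c = h c"
    using gh by (auto simp: lex_less_def)
  have sub: "underS r u \<subseteq> underS r v" if "u \<in> underS r v" for u v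
    using that tr an by (auto simp: underS_def dest: transD antisymD)
  consider "b = d" | "b \<in> underS r d" | "d \<in> underS r b"
    using tot b(1) d(1) by (auto simp: total_on_def underS_def)
  then show ?thesis
  proof cases
    case 1
    then show ?thesis
      unfolding lex_less_def using b d by (intro bexI[of _ b]) auto
  next
    case 2
    then show ?thesis
      unfolding lex_less_def using b d sub[OF 2] by (intro bexI[of _ b]) auto
  next
    case 3
    then show ?thesis
      unfolding lex_less_def using b d sub[OF 3] by (intro bexI[of _ d]) auto
  qed
qed

lemma lex_less_total:
  assumes r: "Well_order r" and f: "f \<in> Field r \<rightarrow>\<^sub>E A" and g: "g \<in> Field r \<rightarrow>\<^sub>E A" and "f \<noteq> g"
  shows "lex_less r f g \<or> lex_less r g f"
proof -
  have "wf (r - Id)"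
    using r by (simp add: well_order_on_def)
  moreover have "\<exists>b. b \<in> {b \<in> Field r. f b \<noteq> g b}"
    using PiE_ext[OF f g] \<open>f \<noteq> g\<close> by auto
  ultimately obtain b where b: "b \<in> {b \<in> Field r. f b \<noteq> g b}"
    "\<And>c. (c, b) \<in> r - Id \<Longrightarrow> c \<notin> {b \<in> Field r. f b \<noteq> g b}"
    by (metis (lifting) wfE_min)
  have "\<forall>c\<in>underS r b. f c = g c"
    using b(2) by (auto simp: underS_def Field_def)
  then show ?thesis
    using b(1) unfolding lex_less_def by (metis (mono_tags, lifting) linorder_neqE mem_Collect_eq)
qed

lemma Field_I_power: "Field (I_power r) = (Field r \<rightarrow>\<^sub>E {0..1})"
  by (auto simp: I_power_def relation_of_def Field_def)

lemma Linear_order_I_power: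
  assumes "Well_order r"
  shows "Linear_order (I_power r)"
  unfolding order_on_defs Field_I_power
proof (intro conjI)
  show "I_power r \<subseteq> (Field r \<rightarrow>\<^sub>E {0..1}) \<times> (Field r \<rightarrow>\<^sub>E {0..1})"
    "refl_on (Field r \<rightarrow>\<^sub>E {0..1}) (I_power r)"
    by (auto simp: I_power_def relation_of_def refl_on_def)
  show "trans (I_power r)"
    using lex_less_trans[OF assms] by (auto simp: I_power_def relation_of_def intro!: transI)
  show "antisym (I_power r)"
    using lex_less_trans[OF assms] lex_less_irrefl
    by (force simp: I_power_def relation_of_def intro!: antisymI)
  show "total_on (Field r \<rightarrow>\<^sub>E {0..1}) (I_power r)"
    using lex_less_total[OF assms]
    by (force simp: I_power_def relation_of_def total_on_def)
qed

section \<open>Initial segments pulled back to the line\<close>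

lemma closed_agree:
  fixes P :: "real \<Rightarrow> 'a \<Rightarrow> real"
  assumes "\<And>b. b \<in> B \<Longrightarrow> continuous_on UNIV (\<lambda>s. P s b)"
  shows "closed {s. \<forall>b\<in>B. P s b = x b}"
proof -
  have "closed (\<Inter>b\<in>B. {s. P s b = x b})"
    using assms by (intro closed_INT ballI closed_Collect_eq) auto
  then show ?thesis
    by (simp add: Collect_ball_eq)
qed

lemma fsigma_lex_segments:
  fixes P :: "real \<Rightarrow> 'a \<Rightarrow> real"
  assumes "countable (Field r)"
    and cont: "\<And>b. b \<in> Field r \<Longrightarrow> continuous_on UNIV (\<lambda>s. P s b)"
  shows "fsigma_in euclidean {s. lex_less r (P s) x}"
    and "fsigma_in euclidean {s. lex_less r x (P s)}"
proof -
  have Fld: "underS r b \<subseteq> Field r" for b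
    by (auto simp: underS_def Field_def)
  have closed: "closed {s. \<forall>c\<in>underS r b. P s c = x c}" for b
    using Fld cont by (intro closed_agree) blast
  have "fsigma_in euclidean ({s. P s b < x b} \<inter> {s. \<forall>c\<in>underS r b. P s c = x c})"
    if "b \<in> Field r" for b
    using cont[OF that] closed
    by (intro fsigma_in_Int closed_imp_fsigma_in open_imp_fsigma_in metrizable_space_euclidean)
      (auto intro: open_Collect_less)
  moreover have "{s. lex_less r (P s) x} =
      (\<Union>b\<in>Field r. {s. P s b < x b} \<inter> {s. \<forall>c\<in>underS r b. P s c = x c})"
    by (auto simp: lex_less_def)
  ultimately show "fsigma_in euclidean {s. lex_less r (P s) x}"
    using assms(1) by (auto intro!: fsigma_in_Union)
  have "fsigma_in euclidean ({s. x b < P s b} \<inter> {s. \<forall>c\<in>underS r b. P s c = x c})"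
    if "b \<in> Field r" for b
    using cont[OF that] closed
    by (intro fsigma_in_Int closed_imp_fsigma_in open_imp_fsigma_in metrizable_space_euclidean)
      (auto intro: open_Collect_less)
  moreover have "{s. lex_less r x (P s)} =
      (\<Union>b\<in>Field r. {s. x b < P s b} \<inter> {s. \<forall>c\<in>underS r b. P s c = x c})"
    by (fastforce simp: lex_less_def)
  ultimately show "fsigma_in euclidean {s. lex_less r x (P s)}"
    using assms(1) by (auto intro!: fsigma_in_Union)
qed

lemma baire1_lex_segment:
  fixes P :: "real \<Rightarrow> 'a \<Rightarrow> real"
  assumes r: "Well_order r" and "countable (Field r)"
    and cont: "\<And>b. b \<in> Field r \<Longrightarrow> continuous_on UNIV (\<lambda>s. P s b)"
    and P: "\<And>s. P s \<in> Field r \<rightarrow>\<^sub>E {0..1}" and x: "x \<in> Field r \<rightarrow>\<^sub>E {0..1}"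
  shows "baire1 (indicator {s. lex_less r (P s) x})"
proof (rule baire1_indicator)
  show "fsigma_in euclidean {s. lex_less r (P s) x}"
    using fsigma_lex_segments(1) assms(2) cont .
  have "- {s. lex_less r (P s) x} = {s. \<forall>b\<in>Field r. P s b = x b} \<union> {s. lex_less r x (P s)}"
  proof (intro equalityI subsetI)
    fix s
    assume "s \<in> - {s. lex_less r (P s) x}"
    then show "s \<in> {s. \<forall>b\<in>Field r. P s b = x b} \<union> {s. lex_less r x (P s)}"
      using lex_less_total[OF r P[of s] x] by auto
  next
    fix s
    assume s: "s \<in> {s. \<forall>b\<in>Field r. P s b = x b} \<union> {s. lex_less r x (P s)}"
    have "P s = x" if "\<forall>b\<in>Field r. P s b = x b"
      using that PiE_ext[OF P[of s] x] by blast
    then show "s \<in> - {s. lex_less r (P s) x}"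
      using s lex_less_trans[OF r, of x "P s" x] lex_less_irrefl[of r x] by auto
  qed
  moreover have "closed {s. \<forall>b\<in>Field r. P s b = x b}"
    using cont by (rule closed_agree)
  ultimately show "fsigma_in euclidean (- {s. lex_less r (P s) x})"
    using fsigma_lex_segments(2)[where P = P, OF assms(2) cont]
    by (simp add: fsigma_in_Un closed_imp_fsigma_in)
qed

text \<open>The real line maps continuously onto the cube \<open>[0,1]\<^sup>A\<close>; continuity is stated for each
  coordinate.\<close>

lemma continuous_surjection_cube:
  fixes A :: "'a set"
  assumes "countable A"
  obtains P :: "real \<Rightarrow> 'a \<Rightarrow> real"
  where "\<And>b. b \<in> A \<Longrightarrow> continuous_on UNIV (\<lambda>s. P s b)" "range P = (A \<rightarrow>\<^sub>E {0..1})"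
proof -
  define P :: "real \<Rightarrow> 'a \<Rightarrow> real" where
    "P = (\<lambda>s. \<lambda>b\<in>A. schoenberg (to_nat_on A b) s)"
  have "x \<in> range P" if x: "x \<in> A \<rightarrow>\<^sub>E {0..1}" for x
  proof -
    define y where "y = (\<lambda>n. if n \<in> to_nat_on A ` A then x (from_nat_into A n) else 0)"
    have "y n \<in> {0..1}" for n
      using x assms by (auto simp: y_def PiE_iff)
    then obtain t where t: "\<And>n. schoenberg n t = y n"
      using schoenberg_surj by blast
    have "P t = x"
    proof (rule PiE_ext[of _ A "\<lambda>_. {0..1}"])
      show "P t \<in> A \<rightarrow>\<^sub>E {0..1}"
        using schoenberg_bounds by (auto simp: P_def)
      show "P t b = x b" if "b \<in> A" for b
        using that assms by (simp add: P_def t y_def)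
    qed (rule x)
    then show ?thesis
      by blast
  qed
  moreover have "P s \<in> A \<rightarrow>\<^sub>E {0..1}" for s
    using schoenberg_bounds by (auto simp: P_def)
  moreover have "continuous_on UNIV (\<lambda>s. P s b)" if "b \<in> A" for b
    using that continuous_schoenberg by (simp add: P_def)
  ultimately show ?thesis
    using that[of P] by blast
qed

lemma representable_I_power:
  assumes r: "Well_order r" and ctb: "countable (Field r)"
  shows "representable (I_power r)"
proof -
  let ?X = "Field r \<rightarrow>\<^sub>E {0..1 :: real}"
  obtain P :: "real \<Rightarrow> 'a \<Rightarrow> real" where
    cont: "\<And>b. b \<in> Field r \<Longrightarrow> continuous_on UNIV (\<lambda>s. P s b)" and ran: "range P = ?X"
    using continuous_surjection_cube[OF ctb] by blast
  have P: "P s \<in> ?X" for s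
    using ran by blast
  define h :: "('a \<Rightarrow> real) \<Rightarrow> real \<Rightarrow> real" where
    "h = (\<lambda>x. indicator {s. lex_less r (P s) x})"
  have lin: "Linear_order (I_power r)"
    using r by (rule Linear_order_I_power)
  have le: "(x, y) \<in> I_power r \<longleftrightarrow> h x \<le> h y" if x: "x \<in> ?X" and y: "y \<in> ?X" for x y
  proof
    assume "(x, y) \<in> I_power r"
    then have "x = y \<or> lex_less r x y"
      by (simp add: I_power_def relation_of_def)
    then show "h x \<le> h y"
      using lex_less_trans[OF r, of _ x y] by (auto simp: h_def le_fun_def indicator_def)
  next
    assume le: "h x \<le> h y"
    have "\<not> lex_less r y x"
    proof
      assume yx: "lex_less r y x"
      \<comment> \<open>The point \<open>y\<close> itself lies in the segment below \<open>x\<close> and not in the one below \<open>y\<close>.\<close>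
      obtain s where "P s = y"
        using ran y by (metis imageE)
      then have "h x s = 1" "h y s = 0"
        using yx lex_less_irrefl[of r y] by (simp_all add: h_def)
      then show False
        using le_funD[OF le, of s] by simp
    qed
    then show "(x, y) \<in> I_power r"
      using lex_less_total[OF r x y] x y by (auto simp: I_power_def relation_of_def)
  qed
  have FieldF: "Field (relation_of (\<le>) (h ` ?X)) = h ` ?X"
    by (auto simp: relation_of_def Field_def)
  have tot: "(x, y) \<in> I_power r \<or> (y, x) \<in> I_power r" if "x \<in> ?X" "y \<in> ?X" for x y
    using lin that by (cases "x = y") (auto simp: order_on_defs total_on_def refl_on_def Field_I_power)
  have "inj_on h ?X"
    using le lin by (intro inj_onI) (metis antisymD order_refl order_on_defs(1-3))
  then have "similar (I_power r) (relation_of (\<le>) (h ` ?X))"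
    unfolding similar_def FieldF Field_I_power
    using le by (intro exI[of _ h]) (auto simp: bij_betw_def relation_of_def)
  moreover have "linear_order_on (h ` ?X) (relation_of (\<le>) (h ` ?X))"
    using tot le
    by (auto simp: order_on_defs refl_on_def total_on_def relation_of_def
        intro!: transI antisymI)
  moreover have "\<forall>f\<in>h ` ?X. baire1 f"
    using baire1_lex_segment[OF r ctb cont P] by (auto simp: h_def)
  ultimately show ?thesis
    unfolding representable_def using lin by blast
qed

lemma countable_Field_below_omega1:
  assumes "r <o omega1"
  shows "countable (Field r)"
proof -
  have "|Field r| \<le>o r"
    using assms card_of_least by (auto simp: ordLess_def)
  then have "|Field r| <o cardSuc natLeq"
    using assms ordLeq_ordLess_trans unfolding omega1_def by blast
  then have "|Field r| \<le>o natLeq"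
    using cardSuc_ordLeq_ordLess[OF natLeq_Card_order card_of_Card_order] by blast
  then show ?thesis
    by (simp add: countable_card_le_natLeq)
qed

theorem theorem3p2:
  fixes \<alpha> :: "'a rel"
  assumes "\<alpha> <o omega1"
  shows "representable (I_power \<alpha>)"
  using assms countable_Field_below_omega1 by (intro representable_I_power) (auto simp: ordLess_def)

end
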